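(* Let $k\geq 2$ be an even integer, and let $G$ be a connected graph of order $$n\geq\frac{2k+3+\sqrt{8k^{2}-8k+1}}{2}.$$ If $$q(G)>2(n-2)+\frac{2k-2}{n-1},$$ then $G$ has the $k$-strong parity property.
   Context: All graphs are finite, undirected and simple. For a graph $G$, $V(G)$ is its vertex set, its order is $n=|V(G)|$, and $d_G(v)$ is the degree of the vertex $v$ in $G$. The signless Laplacian matrix of $G$ is $Q(G)=D(G)+A(G)$, where $A(G)$ is the adjacency matrix of $G$ and $D(G)$ is the diagonal matrix of vertex degrees of $G$. The signless Laplacian spectral radius $q(G)$ is the largest eigenvalue of $Q(G)$. For an even integer $k\geq 2$, a graph $G$ has the $k$-strong parity property if for every $X\subseteq V(G)$ with $|X|$ even, $G$ contains a spanning subgraph $F$ (a subgraph with $V(F)=V(G)$) such that $d_F(u)\equiv 1 \pmod 2$ for each $u\in X$ and $d_F(v)\in\{k,k+2,k+4,\ldots\}$ for each $v\in V(G)\setminus X$. *)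

theory Defs
  imports
    "Graph_Theory.Digraph_Component"
    "Jordan_Normal_Form.Spectral_Radius"
begin

text \<open>
  A finite simple undirected graph is a \<^locale>\<open>pair_graph\<close>: a finite vertex set together
  with a symmetric irreflexive set of ordered pairs, each edge \<open>uv\<close> being stored as the two arcs
  \<open>(u, v)\<close> and \<open>(v, u)\<close>. Hence the number of arcs leaving \<open>v\<close> is the degree of \<open>v\<close>.
\<close>

definition vertex_degree :: "'a pair_pre_digraph \<Rightarrow> 'a \<Rightarrow> nat" where
  "vertex_degree G v = out_degree (with_proj G) v"

text \<open>
  The library's matrices are indexed by natural numbers, so the matrices of a graph are taken with
  respect to a listing \<open>vs\<close> of its vertices without repetitions.
\<close>

definition adjacency_mat :: "'a pair_pre_digraph \<Rightarrow> 'a list \<Rightarrow> real mat" where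
  "adjacency_mat G vs =
     mat (length vs) (length vs) (\<lambda>(i, j). if (vs ! i, vs ! j) \<in> parcs G then 1 else 0)"

definition degree_mat :: "'a pair_pre_digraph \<Rightarrow> 'a list \<Rightarrow> real mat" where
  "degree_mat G vs = mat_diag (length vs) (\<lambda>i. real (vertex_degree G (vs ! i)))"

definition signless_laplacian :: "'a pair_pre_digraph \<Rightarrow> 'a list \<Rightarrow> real mat" where
  "signless_laplacian G vs = degree_mat G vs + adjacency_mat G vs"

definition vertex_list :: "'a pair_pre_digraph \<Rightarrow> 'a list" where
  "vertex_list G = (SOME vs. distinct vs \<and> set vs = pverts G)"

text \<open>
  The matrix of a simple graph is real symmetric, so all its eigenvalues are real and \<^const>\<open>spectrum\<close> over the
  reals misses none of them; by \<open>spectrum_signless_laplacian\<close> below the choice of the listing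
  is immaterial. Note that \<^const>\<open>spectral_radius\<close> of the library is a maximum of moduli.
\<close>

definition signless_spectral_radius :: "'a pair_pre_digraph \<Rightarrow> real" where
  "signless_spectral_radius G = Max (spectrum (signless_laplacian G (vertex_list G)))"

definition strong_parity_property :: "nat \<Rightarrow> 'a pair_pre_digraph \<Rightarrow> bool" where
  "strong_parity_property k G \<longleftrightarrow>
     (\<forall>X. X \<subseteq> pverts G \<and> even (card X) \<longrightarrow>
        (\<exists>F. pair_graph F \<and> spanning (with_proj F) (with_proj G) \<and>
             (\<forall>u\<in>X. odd (vertex_degree F u)) \<and>
             (\<forall>v\<in>pverts G - X. vertex_degree F v \<in> {k + 2 * j |j. True})))"

lemma vertex_list:
  assumes "finite (pverts G)"
  shows "distinct (vertex_list G)" "set (vertex_list G) = pverts G"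
proof -
  have "\<exists>vs. distinct vs \<and> set vs = pverts G"
    using finite_distinct_list[OF assms] by blast
  then have "distinct (vertex_list G) \<and> set (vertex_list G) = pverts G"
    unfolding vertex_list_def by (rule someI_ex)
  then show "distinct (vertex_list G)" "set (vertex_list G) = pverts G" by auto
qed

lemma eigenvalue_signless_laplacian:
  assumes d: "distinct vs"
  shows "eigenvalue (signless_laplacian G vs) c \<longleftrightarrow>
    (\<exists>x. (\<exists>v\<in>set vs. x v \<noteq> 0) \<and>
         (\<forall>u\<in>set vs. real (vertex_degree G u) * x u + (\<Sum>v | v \<in> set vs \<and> (u, v) \<in> parcs G. x v)
                      = c * x u))"
    (is "?L \<longleftrightarrow> ?R")
proof -
  let ?n = "length vs" and ?Q = "signless_laplacian G vs"
  have bij: "bij_betw ((!) vs) {0..<?n} (set vs)"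
    using bij_betw_nth[OF d] by (simp add: atLeast0LessThan)
  have dim: "dim_row ?Q = ?n" "dim_col ?Q = ?n"
    by (simp_all add: signless_laplacian_def degree_mat_def adjacency_mat_def mat_diag_def)
  have Q: "?Q $$ (i, j) = (if i = j then real (vertex_degree G (vs ! i)) else 0)
      + (if (vs ! i, vs ! j) \<in> parcs G then 1 else 0)" if "i < ?n" "j < ?n" for i j
    using that
    by (simp add: signless_laplacian_def degree_mat_def adjacency_mat_def mat_diag_def)
  have row: "(?Q *\<^sub>v w) $ i = real (vertex_degree G (vs ! i)) * x (vs ! i)
      + (\<Sum>v | v \<in> set vs \<and> (vs ! i, v) \<in> parcs G. x v)"
    if i: "i < ?n" and w: "dim_vec w = ?n" "\<And>j. j < ?n \<Longrightarrow> w $ j = x (vs ! j)" for w x i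
  proof -
    have "(?Q *\<^sub>v w) $ i = (\<Sum>j\<in>{0..<?n}. ?Q $$ (i, j) * w $ j)"
      using i w by (simp add: scalar_prod_def dim)
    also have "\<dots> = (\<Sum>j\<in>{0..<?n}. (if i = j then real (vertex_degree G (vs ! i)) * x (vs ! j) else 0)
        + (if (vs ! i, vs ! j) \<in> parcs G then x (vs ! j) else 0))"
      by (rule sum.cong) (use i w Q in \<open>auto simp: algebra_simps\<close>)
    also have "\<dots> = real (vertex_degree G (vs ! i)) * x (vs ! i)
        + (\<Sum>j\<in>{0..<?n}. if (vs ! i, vs ! j) \<in> parcs G then x (vs ! j) else 0)"
      using i by (simp add: sum.distrib)
    also have "(\<Sum>j\<in>{0..<?n}. if (vs ! i, vs ! j) \<in> parcs G then x (vs ! j) else 0)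
        = (\<Sum>v\<in>set vs. if (vs ! i, v) \<in> parcs G then x v else 0)"
      by (rule sum.reindex_bij_betw[OF bij])
    also have "\<dots> = (\<Sum>v | v \<in> set vs \<and> (vs ! i, v) \<in> parcs G. x v)"
      by (simp add: sum.inter_filter)
    finally show ?thesis .
  qed
  show ?thesis
  proof
    assume ?L
    then obtain w where w: "dim_vec w = ?n" "w \<noteq> 0\<^sub>v ?n" "?Q *\<^sub>v w = c \<cdot>\<^sub>v w"
      unfolding eigenvalue_def eigenvector_def dim using carrier_vecD by blast
    define x where "x v = w $ (the_inv_into {0..<?n} ((!) vs) v)" for v
    have x: "w $ j = x (vs ! j)" if "j < ?n" for j
      using that bij by (simp add: x_def bij_betw_def the_inv_into_f_f)
    have "\<exists>j<?n. w $ j \<noteq> 0"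
    proof (rule ccontr)
      assume "\<not> (\<exists>j<?n. w $ j \<noteq> 0)"
      then have "w = 0\<^sub>v ?n" using w(1) by (intro eq_vecI) auto
      then show False using w(2) by simp
    qed
    then obtain j where "j < ?n" "w $ j \<noteq> 0" by blast
    then have "vs ! j \<in> set vs" "x (vs ! j) \<noteq> 0" using x[of j] by auto
    then have "\<exists>v\<in>set vs. x v \<noteq> 0" by blast
    moreover have "real (vertex_degree G u) * x u + (\<Sum>v | v \<in> set vs \<and> (u, v) \<in> parcs G. x v) = c * x u"
      if "u \<in> set vs" for u
    proof -
      from that obtain i where i: "i < ?n" "u = vs ! i" by (metis in_set_conv_nth)
      have "(?Q *\<^sub>v w) $ i = c * x u"
        unfolding w(3) using i w(1) x[OF i(1)] by simp
      then show ?thesis using row[of i w x, OF i(1) w(1) x] i(2) by simp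
    qed
    ultimately show ?R by blast
  next
    assume ?R
    then obtain x where x: "\<exists>v\<in>set vs. x v \<noteq> 0" "\<And>u. u \<in> set vs \<Longrightarrow>
      real (vertex_degree G u) * x u + (\<Sum>v | v \<in> set vs \<and> (u, v) \<in> parcs G. x v) = c * x u" by blast
    define w where "w = vec ?n (\<lambda>i. x (vs ! i))"
    have w: "dim_vec w = ?n" "\<And>j. j < ?n \<Longrightarrow> w $ j = x (vs ! j)" by (simp_all add: w_def)
    from x(1) obtain j where "j < ?n" "x (vs ! j) \<noteq> 0" by (metis in_set_conv_nth)
    then have "w \<noteq> 0\<^sub>v ?n" using w(2) by force
    moreover have "?Q *\<^sub>v w = c \<cdot>\<^sub>v w"
    proof (rule eq_vecI)
      fix i assume "i < dim_vec (c \<cdot>\<^sub>v w)"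
      then have i: "i < ?n" using w(1) by simp
      show "(?Q *\<^sub>v w) $ i = (c \<cdot>\<^sub>v w) $ i"
        using row[of i w x, OF i w] x(2)[OF nth_mem[OF i]] i w(1) w(2)[OF i] by simp
    qed (simp add: dim w(1))
    ultimately have "eigenvector ?Q w c"
      unfolding eigenvector_def dim using carrier_vecI[OF w(1)] by blast
    then show ?L unfolding eigenvalue_def by blast
  qed
qed

lemma spectrum_signless_laplacian:
  assumes "finite (pverts G)" "distinct vs" "set vs = pverts G"
  shows "spectrum (signless_laplacian G (vertex_list G)) = spectrum (signless_laplacian G vs)"
  unfolding spectrum_def eigenvalue_signless_laplacian[OF assms(2)]
    eigenvalue_signless_laplacian[OF vertex_list(1)[OF assms(1)]]
  by (simp only: vertex_list(2)[OF assms(1)] assms(3))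

end

theory Submission
  imports Defs
begin

text \<open>
  Write \<open>m\<close> for the number of edges. The bound \<open>q(G) \<le> 2 m / (n - 1) + n - 2\<close> turns the hypothesis into:
  fewer than \<open>n - k\<close> edges are missing from the complete graph. Hence
  \<open>d(u) + d(v)\<close> is at least \<open>n - 1 + k\<close> for adjacent and \<open>n - 2 + k\<close> for nonadjacent \<open>u, v\<close>.

  For even \<open>X\<close> let \<open>T\<close> be the set of vertices whose degree in \<open>G\<close> has the wrong parity. It suffices to
  delete from \<open>G\<close> a set \<open>J\<close> of edges whose odd-degree vertices are exactly those of \<open>T\<close>, leaving all degrees
  at least \<open>k - 1\<close>; parity then gives \<open>k\<close> outside \<open>X\<close>. Pair up the vertices of \<open>T\<close> with as
  many adjacent pairs as possible; let \<open>J\<close> consist of the edges of the adjacent pairs and, for each other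
  pair \<open>x, y\<close>, of a path \<open>x w y\<close>. Maximality makes the vertices of nonadjacent pairs independent, and
  the partner of \<open>w\<close>, if any, nonadjacent to \<open>x\<close>. So all but one of the \<open>J\<close>-neighbours of \<open>w\<close> are
  nonneighbours of \<open>x\<close>, and \<open>d(x) + d(w) \<ge> n - 1 + k\<close> bounds their number by \<open>d(w) - k\<close>.
\<close>

section \<open>Pairings of a finite set and the exchange of partners\<close>

text \<open>A perfect matching of \<open>T\<close>, its pairs adjacent or not, is encoded as a
  fixed-point-free involution, so that exchanging partners is a function update.\<close>

definition pairing :: "'a set \<Rightarrow> ('a \<Rightarrow> 'a) \<Rightarrow> bool" where
  "pairing T p \<longleftrightarrow> (\<forall>v\<in>T. p v \<in> T \<and> p (p v) = v \<and> p v \<noteq> v)"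

lemma card_Diff_pair:
  assumes "finite T" "a \<in> T" "b \<in> T" "a \<noteq> b"
  shows "card T = card (T - {a, b}) + 2"
proof -
  have "card (T - {a, b}) = card T - 2" using assms by (subst card_Diff_subset) auto
  moreover have "card T \<ge> 2" using assms card_mono[of T "{a, b}"] by simp
  ultimately show ?thesis by simp
qed

lemma pairing_remove:
  assumes "pairing T p" "a \<in> T"
  shows "pairing (T - {a, p a}) p"
  unfolding pairing_def
proof (intro ballI)
  fix v assume v: "v \<in> T - {a, p a}"
  have p: "p v \<in> T" "p (p v) = v" "p v \<noteq> v" "p (p a) = a"
    using assms v unfolding pairing_def by blast+
  then have "p v \<notin> {a, p a}" using v by (metis Diff_iff insert_iff singletonD)
  with p show "p v \<in> T - {a, p a} \<and> p (p v) = v \<and> p v \<noteq> v" by blast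
qed

lemma pairing_imp_even_card:
  assumes "finite T" "pairing T p"
  shows "even (card T)"
  using assms
proof (induction T rule: finite_psubset_induct)
  case (psubset T)
  show ?case
  proof (cases "T = {}")
    case False
    then obtain a where a: "a \<in> T" by blast
    then have pa: "p a \<in> T" "p a \<noteq> a" using psubset.prems by (auto simp: pairing_def)
    have "even (card (T - {a, p a}))"
      by (rule psubset.IH[OF _ pairing_remove[OF psubset.prems a]]) (use a in blast)
    moreover have "card T = card (T - {a, p a}) + 2"
      using card_Diff_pair[OF psubset.hyps a pa(1)] pa(2) by simp
    ultimately show ?thesis by simp
  qed simp
qed

lemma ex_pairing:
  assumes "finite T" "even (card T)"
  shows "\<exists>p. pairing T p"
  using assms
proof (induction T rule: finite_psubset_induct)
  case (psubset T)
  show ?case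
  proof (cases "T = {}")
    case False
    then obtain a where a: "a \<in> T" by blast
    have "T \<noteq> {a}" using psubset.prems by auto
    then obtain b where b: "b \<in> T" "a \<noteq> b" using a by blast
    have "card T = card (T - {a, b}) + 2"
      using card_Diff_pair[OF psubset.hyps a b] by simp
    then obtain p where "pairing (T - {a, b}) p"
      using a psubset.IH[of "T - {a, b}"] psubset.prems by auto
    then have "pairing T (p(a := b, b := a))"
      using a b by (auto simp: pairing_def)
    then show ?thesis by blast
  qed (simp add: pairing_def)
qed

text \<open>
  If \<open>a\<close> failed the conclusion, exchanging the partners of \<open>x\<close> and \<open>p a\<close> would increase the number
  of adjacent pairs.
\<close>

lemma max_pairing_exchange:
  assumes fin: "finite T" and E: "sym E" "irrefl E" and p: "pairing T p"
    and max: "\<And>p'. pairing T p' \<Longrightarrow>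
      card {v \<in> T. (v, p' v) \<in> E} \<le> card {v \<in> T. (v, p v) \<in> E}"
    and x: "x \<in> T" "(x, p x) \<notin> E" and a: "a \<in> T" "(a, x) \<in> E"
  shows "(a, p a) \<in> E \<and> (p a, p x) \<notin> E"
proof (rule ccontr)
  assume bad: "\<not> ((a, p a) \<in> E \<and> (p a, p x) \<notin> E)"
  have pT: "p v \<in> T" "p (p v) = v" "p v \<noteq> v" if "v \<in> T" for v
    using p that by (auto simp: pairing_def)
  define y b where "y = p x" and "b = p a"
  have y: "y \<in> T" "p y = x" "y \<noteq> x" and b: "b \<in> T" "p b = a" "b \<noteq> a"
    unfolding y_def b_def using pT x(1) a(1) by blast+
  have xy: "(x, y) \<notin> E" "(y, x) \<notin> E" and xa: "(x, a) \<in> E"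
    using x(2) a(2) E(1) by (auto simp: y_def dest: symD)
  have ne: "a \<noteq> x" "a \<noteq> y" "b \<noteq> x" "b \<noteq> y"
  proof -
    show "a \<noteq> x" using a(2) E(2) by (auto simp: irrefl_def)
    then show "b \<noteq> y" using y(2) b(2) by auto
    show "a \<noteq> y" using xa xy by auto
    then show "b \<noteq> x" using b(2) y_def by auto
  qed
  \<comment> \<open>The pairs \<open>x y\<close> and \<open>a b\<close> become \<open>x a\<close>
    and \<open>y b\<close>.\<close>
  define p' where "p' = p(x := a, a := x, y := b, b := y)"
  have p'_eq: "p' x = a" "p' a = x" "p' y = b" "p' b = y"
    using ne y(3) b(3) by (auto simp: p'_def)
  have p'_other: "p' v = p v" if "v \<notin> {x, a, y, b}" for v using that by (simp add: p'_def)
  have p': "pairing T p'"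
    unfolding pairing_def
  proof (intro ballI)
    fix v assume v: "v \<in> T"
    show "p' v \<in> T \<and> p' (p' v) = v \<and> p' v \<noteq> v"
    proof (cases "v \<in> {x, a, y, b}")
      case True
      then show ?thesis using p'_eq x(1) a(1) y(1) b(1) ne by auto
    next
      case False
      then have "p v \<notin> {x, a, y, b}" using pT(2)[OF v] y(2) b(2) y_def b_def by auto
      then show ?thesis using False p'_other pT[OF v] by simp
    qed
  qed
  let ?A = "{v \<in> T. (v, p v) \<in> E}" and ?A' = "{v \<in> T. (v, p' v) \<in> E}"
  have A': "v \<in> ?A'" if "v \<in> ?A" "v \<notin> {x, a, y, b}" for v
    using that p'_other by simp
  have xA: "x \<in> ?A'" "a \<in> ?A'" "x \<notin> ?A" "y \<notin> ?A"
    using x(1) a xa xy p'_eq y(2) by (simp_all add: y_def)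
  \<comment> \<open>Of the four vertices only \<open>a\<close> and \<open>b\<close> can lie in
    \<open>?A\<close>, while \<open>x\<close> and \<open>a\<close> lie in \<open>?A'\<close>. So
    only \<open>b\<close> could be lost: it is not in \<open>?A\<close> if \<open>a b\<close> is no
    edge, and it is in \<open>?A'\<close> if \<open>b y\<close> is one.\<close>
  have "?A \<subset> ?A'" if ab: "(a, b) \<notin> E"
  proof -
    have "(b, a) \<notin> E" using ab E(1) by (auto dest: symD)
    then have "b \<notin> ?A" by (simp add: b(2))
    then show ?thesis using A' xA by blast
  qed
  moreover have "?A \<subset> ?A'" if adj: "(b, y) \<in> E"
  proof -
    have "b \<in> ?A'" using adj p'_eq b(1) by simp
    then show ?thesis using A' xA by blast
  qed
  ultimately have "?A \<subset> ?A'" using bad unfolding y_def b_def by blast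
  then have "card ?A < card ?A'" using fin by (intro psubset_card_mono) auto
  then show False using max[OF p'] by simp
qed

section \<open>Correcting parities by deleting edges\<close>

text \<open>Reversal of arcs is a fixed-point-free involution on \<open>E\<close>.\<close>

lemma even_card_sym_rel:
  assumes "finite E" "sym E" "irrefl E"
  shows "even (card E)"
proof (rule pairing_imp_even_card)
  have "(b, a) \<in> E \<and> a \<noteq> b" if "(a, b) \<in> E" for a b
    using symD[OF assms(2) that] assms(3) that by (auto simp: irrefl_def)
  then show "pairing E prod.swap" by (auto simp: pairing_def)
qed (fact assms(1))

lemma sum_card_Image:
  assumes "finite V" "E \<subseteq> V \<times> V"
  shows "(\<Sum>v\<in>V. card (E `` {v})) = card E"
proof -
  have "E = Sigma V (\<lambda>v. E `` {v})" using assms by auto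
  moreover have "finite (E `` {v})" for v
    by (rule finite_subset[of _ V]) (use assms in auto)
  ultimately show ?thesis using assms by (metis card_SigmaI)
qed

text \<open>Wrong parity means that the degree plus \<open>of_bool (v \<in> X)\<close> is odd, and
  these numbers sum to \<open>card E + card X\<close>, both even.\<close>

lemma even_card_wrong_parity:
  assumes V: "finite V" and E: "E \<subseteq> V \<times> V" "sym E" "irrefl E"
    and X: "X \<subseteq> V" "even (card X)"
  shows "even (card {v \<in> V. odd (card (E `` {v})) \<noteq> (v \<in> X)})"
proof -
  have "even (card E)"
    by (rule even_card_sym_rel) (use V E in \<open>auto intro: finite_subset[of _ "V \<times> V"]\<close>)
  moreover have "(\<Sum>v\<in>V. card (E `` {v}) + of_bool (v \<in> X)) = card E + card X"
    using V X by (simp add: sum.distrib sum_card_Image[OF V E(1)] Int_absorb1)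
  ultimately have "even (\<Sum>v\<in>V. card (E `` {v}) + of_bool (v \<in> X))" using X by simp
  then have "even (card {v \<in> V. odd (card (E `` {v}) + of_bool (v \<in> X))})"
    by (simp only: even_sum_iff[OF V])
  also have "{v \<in> V. odd (card (E `` {v}) + of_bool (v \<in> X))}
      = {v \<in> V. odd (card (E `` {v})) \<noteq> (v \<in> X)}" by auto
  finally show ?thesis .
qed

lemma parity_subgraph_of_large_degrees:
  fixes E :: "('a \<times> 'a) set"
  assumes V: "finite V" and E: "E \<subseteq> V \<times> V" "sym E" "irrefl E"
    and X: "X \<subseteq> V" "even (card X)" and k: "k \<ge> 1"
    and deg: "\<And>v. v \<in> V \<Longrightarrow> card (E `` {v}) \<ge> k"
    and adj: "\<And>u v. (u, v) \<in> E \<Longrightarrow> card (E `` {u}) + card (E `` {v}) + 1 \<ge> card V + k"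
    and nonadj: "\<And>u v. u \<in> V \<Longrightarrow> v \<in> V \<Longrightarrow> u \<noteq> v \<Longrightarrow> (u, v) \<notin> E \<Longrightarrow>
      card (E `` {u}) + card (E `` {v}) + 2 \<ge> card V + k"
  shows "\<exists>F\<subseteq>E. sym F \<and> (\<forall>v\<in>V. odd (card (F `` {v})) = (v \<in> X)) \<and>
    (\<forall>v\<in>V. card (F `` {v}) + 1 \<ge> k)"
proof -
  define T where "T = {v \<in> V. odd (card (E `` {v})) \<noteq> (v \<in> X)}"
  have T: "T \<subseteq> V" "finite T" using V by (auto simp: T_def)
  have nsub: "E `` {v} \<subseteq> V" and nfin: "finite (E `` {v})" for v
    using E V by (auto intro: finite_subset[of _ V])
  have symE: "(u, v) \<in> E \<longleftrightarrow> (v, u) \<in> E" for u v using E by (auto simp: sym_def)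
  have irr: "(v, v) \<notin> E" for v using E by (auto simp: irrefl_def)
  obtain p0 where p0: "pairing T p0"
    using ex_pairing[OF T(2)] even_card_wrong_parity[OF V E X] by (auto simp: T_def)
  let ?m = "\<lambda>p. card {v \<in> T. (v, p v) \<in> E}"
  \<comment> \<open>The count is bounded by \<open>card T\<close>, so some pairing has the most
    adjacent pairs.\<close>
  have "\<forall>p. pairing T p \<longrightarrow> ?m p < Suc (card T)"
    using T by (auto simp: less_Suc_eq_le intro: card_mono)
  from ex_has_greatest_nat[OF p0 this] obtain p where p: "pairing T p"
    and max: "\<And>p'. pairing T p' \<Longrightarrow> ?m p' \<le> ?m p" by blast
  note exch = max_pairing_exchange[OF T(2) E(2,3) p max]
  have pT: "p v \<in> T" "p (p v) = v" "p v \<noteq> v" if "v \<in> T" for v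
    using p that by (auto simp: pairing_def)
  define U where "U = {v \<in> T. (v, p v) \<notin> E}"
  have U: "U \<subseteq> T" "finite U" using T by (auto simp: U_def)
  have pU: "p v \<in> U \<longleftrightarrow> v \<in> U" if "v \<in> T" for v
    using pT[OF that] that symE by (auto simp: U_def)
  \<comment> \<open>By the exchange with \<open>x := v\<close> and \<open>a := u\<close>, an edge
    \<open>u v\<close> inside \<open>U\<close> would make \<open>u\<close> adjacent to
    \<open>p u\<close>.\<close>
  have indep: "(u, v) \<notin> E" if "u \<in> U" "v \<in> U" for u v
    using exch[of v u] that by (auto simp: U_def)

  \<comment> \<open>Disjoint neighbourhoods would fit into \<open>V - {x, p x}\<close>, so the two
    degrees would sum to at most \<open>card V - 2\<close>, against \<open>nonadj\<close> with
    \<open>k \<ge> 1\<close>.\<close>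
  have common: "\<exists>w. w \<in> E `` {x} \<inter> E `` {p x}" if x: "x \<in> U" for x
  proof (rule ccontr)
    let ?A = "E `` {x}" and ?B = "E `` {p x}"
    assume "\<not> ?thesis"
    then have "card (?A \<union> ?B) = card ?A + card ?B"
      by (intro card_Un_disjoint nfin) auto
    moreover have "?A \<union> ?B \<subseteq> V - {x, p x}"
      using nsub irr x symE by (auto simp: U_def)
    then have "card (?A \<union> ?B) \<le> card (V - {x, p x})" using V by (intro card_mono) auto
    moreover have xV: "x \<in> V" "p x \<in> V" "p x \<noteq> x" using x U T pT by auto
    then have "card V = card (V - {x, p x}) + 2"
      using card_Diff_pair[OF V xV(1,2)] by simp
    moreover have "card ?A + card ?B + 2 \<ge> card V + k"
      using nonadj[OF xV(1,2)] x xV by (auto simp: U_def)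
    ultimately show False using k by simp
  qed
  \<comment> \<open>The choice depends only on the intersection, so both ends of a pair get the same
    middle vertex.\<close>
  define c where "c x = (SOME w. w \<in> E `` {x} \<inter> E `` {p x})" for x
  have c: "(x, c x) \<in> E" "(p x, c x) \<in> E" if "x \<in> U" for x
    using someI_ex[OF common[OF that]] by (auto simp: c_def)
  have cp: "c (p x) = c x" if "x \<in> U" for x
  proof -
    have "p (p x) = x" using that U pT by blast
    then show ?thesis by (simp only: c_def Int_commute)
  qed
  have cU: "c x \<notin> U" if "x \<in> U" for x using c(1)[OF that] indep that by blast
  \<comment> \<open>The ends of all paths with middle vertex \<open>w\<close>. Since
    \<open>p\<close> pairs them up, these paths do not change the parity at
    \<open>w\<close>.\<close>
  define W where "W w = {x \<in> U. c x = w}" for w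
  have W: "finite (W w)" "W w \<subseteq> U" for w using U by (auto simp: W_def)
  have evenW: "even (card (W w))" for w
    by (rule pairing_imp_even_card[of _ p])
       (use U pU pT cp in \<open>auto simp: W_def pairing_def\<close>)

  define J where "J = {(v, p v) |v. v \<in> T - U} \<union> {(x, c x) |x. x \<in> U} \<union> {(c x, x) |x. x \<in> U}"
  have JE: "J \<subseteq> E" using c symE by (auto simp: J_def U_def)
  have symJ: "sym J"
  proof -
    have "\<exists>v'\<in>T - U. (p v, v) = (v', p v')" if "v \<in> T - U" for v
      using that pT[of v] pU[of v] by (intro bexI[of _ "p v"]) auto
    then show ?thesis unfolding sym_def J_def by blast
  qed
  have Jdeg: "card (J `` {v}) = of_bool (v \<in> T) + card (W v)" for v
  proof (cases "v \<in> U")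
    case True
    then have "W v = {}" using cU by (auto simp: W_def)
    moreover have "J `` {v} = {c v}" using True cU by (auto simp: J_def)
    ultimately show ?thesis using True U by auto
  next
    case False
    then have "J `` {v} = (if v \<in> T then insert (p v) (W v) else W v)"
      by (auto simp: J_def W_def)
    moreover have "v \<in> T \<Longrightarrow> p v \<notin> W v" using False pU W by blast
    ultimately show ?thesis using W by auto
  qed
  have Fdeg: "card ((E - J) `` {v}) + of_bool (v \<in> T) + card (W v) = card (E `` {v})" for v
  proof -
    have "(E - J) `` {v} = E `` {v} - J `` {v}" by auto
    moreover have "J `` {v} \<subseteq> E `` {v}" using JE by auto
    ultimately have "card ((E - J) `` {v}) + card (J `` {v}) = card (E `` {v})"
      using nfin by (metis card_Diff_subset card_mono finite_subset le_add_diff_inverse2)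
    then show ?thesis using Jdeg by simp
  qed
  have bound: "card (E `` {w}) + 1 \<ge> k + of_bool (w \<in> T) + card (W w)" if w: "w \<in> V" for w
  proof (cases "W w = {}")
    case True
    then show ?thesis using deg[OF w] by simp
  next
    case False
    then obtain x where x: "x \<in> U" "c x = w" by (auto simp: W_def)
    have xw: "(x, w) \<in> E" "(p x, w) \<in> E" using c[OF x(1)] x(2) by auto
    have wU: "w \<notin> U" using cU x by auto
    \<comment> \<open>\<open>B\<close> consists of the \<open>J\<close>-neighbours of
      \<open>w\<close> and avoids the neighbourhood of \<open>x\<close>: \<open>W w\<close>, which
      contains \<open>x\<close> itself, by independence of \<open>U\<close>, and \<open>p w\<close>
      by the exchange at \<open>p x\<close> and \<open>w\<close>. Hence the degree of
      \<open>x\<close> plus \<open>card B\<close> is at most \<open>card V\<close>, and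
      \<open>adj\<close> for the edge \<open>x w\<close> concludes.\<close>
    define B where "B = (if w \<in> T then insert (p w) (W w) else W w)"
    have cardB: "card B = of_bool (w \<in> T) + card (W w)"
    proof (cases "w \<in> T")
      case True
      then have "p w \<notin> W w" using W wU pU by blast
      then show ?thesis using W True by (simp add: B_def)
    qed (simp add: B_def)
    have "(x, p w) \<notin> E" if "w \<in> T"
    proof -
      have "x \<in> T" using x U by blast
      moreover have "p x \<in> U" using pU x(1) \<open>x \<in> T\<close> by blast
      ultimately show ?thesis
        using exch[of "p x" w] that xw(2) pT[of x] symE by (auto simp: U_def)
    qed
    moreover have "E `` {x} \<inter> W w = {}" using indep x(1) W(2)[of w] by blast
    ultimately have "E `` {x} \<inter> B = {}" by (simp add: B_def)
    then have "card (E `` {x}) + card B = card (E `` {x} \<union> B)"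
      by (intro card_Un_disjoint[symmetric] nfin) (use W in \<open>auto simp: B_def\<close>)
    also have "\<dots> \<le> card V"
    proof (rule card_mono[OF V])
      have "B \<subseteq> T" using W(2)[of w] U(1) pT(1)[of w] by (auto simp: B_def)
      then show "E `` {x} \<union> B \<subseteq> V" using nsub T(1) by blast
    qed
    finally show ?thesis using adj[OF xw(1)] cardB by simp
  qed
  show ?thesis
  proof (intro exI[of _ "E - J"] conjI ballI)
    show "sym (E - J)" using E(2) symJ unfolding sym_def by blast
  next
    fix v assume v: "v \<in> V"
    show "odd (card ((E - J) `` {v})) = (v \<in> X)"
    proof -
      have "odd (card (E `` {v})) = (odd (card ((E - J) `` {v})) \<noteq> (v \<in> T))"
        unfolding Fdeg[of v, symmetric] using evenW[of v] by simp
      then show ?thesis using v by (simp add: T_def) blast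
    qed
    show "k \<le> card ((E - J) `` {v}) + 1" using Fdeg[of v] bound[OF v] by simp
  qed blast
qed

section \<open>Bounding signless Laplacian eigenvalues by the number of edges\<close>

text \<open>Both sides count the arcs between \<open>A\<close> and \<open>B\<close>, once from
  either end.\<close>

lemma sum_card_Image_Int_swap:
  assumes "finite A" "finite B" "sym E"
  shows "(\<Sum>u\<in>A. card (E `` {u} \<inter> B)) = (\<Sum>w\<in>B. card (E `` {w} \<inter> A))"
proof -
  have eq: "card (E `` {u} \<inter> C) = (\<Sum>w\<in>C. of_bool ((u, w) \<in> E))" if "finite C" for u C
  proof -
    have "E `` {u} \<inter> C = {w \<in> C. (u, w) \<in> E}" by auto
    then show ?thesis using that by (simp add: sum.If_cases of_bool_def Int_def)
  qed
  have "(\<Sum>u\<in>A. \<Sum>w\<in>B. of_bool ((u, w) \<in> E)) = (\<Sum>w\<in>B. \<Sum>u\<in>A. of_bool ((u, w) \<in> E) :: nat)"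
    by (rule sum.swap)
  also have "\<dots> = (\<Sum>w\<in>B. \<Sum>u\<in>A. of_bool ((w, u) \<in> E))"
    using assms(3) by (intro sum.cong) (auto simp: sym_def of_bool_def)
  finally show ?thesis using assms by (simp add: eq)
qed

text \<open>A complex eigenvalue exists, symmetry makes it real, and the real or the imaginary part
  of its eigenvector is a nonzero real eigenvector.\<close>

lemma real_symmetric_spectrum_nonempty:
  fixes A :: "real mat"
  assumes A: "A \<in> carrier_mat n n" and n: "n > 0"
    and sym: "\<And>i j. i < n \<Longrightarrow> j < n \<Longrightarrow> A $$ (i, j) = A $$ (j, i)"
  shows "spectrum A \<noteq> {}"
proof -
  let ?C = "map_mat complex_of_real A"
  have C: "?C \<in> carrier_mat n n" using A by simp
  obtain c w where w: "w \<in> carrier_vec n" "w \<noteq> 0\<^sub>v n" "?C *\<^sub>v w = c \<cdot>\<^sub>v w"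
    using spectrum_non_empty[OF C n] A
    by (auto simp: spectrum_def eigenvalue_def eigenvector_def)
  have row: "(\<Sum>j<n. of_real (A $$ (i, j)) * w $ j) = c * w $ i" if "i < n" for i
  proof -
    have "(?C *\<^sub>v w) $ i = (\<Sum>j<n. of_real (A $$ (i, j)) * w $ j)"
      using that A w(1) by (simp add: scalar_prod_def atLeast0LessThan)
    then show ?thesis using w that by simp
  qed
  define D where "D = (\<Sum>i<n. (cmod (w $ i)) ^ 2)"
  \<comment> \<open>\<open>S\<close> is the Hermitian form of \<open>A\<close> at \<open>w\<close>:
    it equals \<open>c\<close> times the squared norm \<open>D\<close>, and it is real by
    symmetry.\<close>
  define S where "S = (\<Sum>i<n. (\<Sum>j<n. of_real (A $$ (i, j)) * w $ j) * cnj (w $ i))"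
  have ex: "\<exists>i<n. w $ i \<noteq> 0"
  proof (rule ccontr)
    assume "\<not> ?thesis"
    then have "w = 0\<^sub>v n" using w(1) by (intro eq_vecI) auto
    then show False using w(2) by simp
  qed
  then obtain i where "i < n" "w $ i \<noteq> 0" by blast
  then have "D > 0" unfolding D_def by (intro sum_pos2[of _ i]) auto
  have "S = c * of_real D"
    by (simp add: S_def D_def row sum_distrib_left mult.assoc flip: complex_norm_square of_real_power)
  moreover have "cnj S = S"
  proof -
    have "cnj S = (\<Sum>i<n. \<Sum>j<n. of_real (A $$ (i, j)) * cnj (w $ j) * w $ i)"
      by (simp add: S_def sum_distrib_right)
    also have "\<dots> = (\<Sum>j<n. \<Sum>i<n. of_real (A $$ (i, j)) * cnj (w $ j) * w $ i)"
      by (rule sum.swap)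
    also have "\<dots> = S"
      unfolding S_def sum_distrib_right by (intro sum.cong refl) (simp add: sym mult_ac)
    finally show ?thesis .
  qed
  ultimately have "cnj c = c" using \<open>D > 0\<close> by simp
  then have cRe: "c = of_real (Re c)" by (simp add: complex_eq_iff)
  \<comment> \<open>\<open>Re\<close> and \<open>Im\<close> are real-linear and so commute with the
    real matrix; both are treated at once.\<close>
  have "eigenvalue A (Re c)"
    if f: "f \<in> {Re, Im}" and nz: "\<exists>i<n. f (w $ i) \<noteq> 0" for f
  proof -
    define y where "y = vec n (\<lambda>i. f (w $ i))"
    have "y \<noteq> 0\<^sub>v n" using nz by (auto simp: y_def vec_eq_iff)
    moreover have "A *\<^sub>v y = Re c \<cdot>\<^sub>v y"
    proof (rule eq_vecI)
      fix i assume "i < dim_vec (Re c \<cdot>\<^sub>v y)"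
      then have i: "i < n" by (simp add: y_def)
      have "(A *\<^sub>v y) $ i = (\<Sum>j<n. A $$ (i, j) * f (w $ j))"
        using i A by (simp add: scalar_prod_def y_def atLeast0LessThan)
      also have "\<dots> = f (\<Sum>j<n. of_real (A $$ (i, j)) * w $ j)"
        using f by auto
      also have "\<dots> = f (of_real (Re c) * w $ i)"
        using row[OF i] cRe by simp
      also have "\<dots> = Re c * f (w $ i)" using f by auto
      finally show "(A *\<^sub>v y) $ i = (Re c \<cdot>\<^sub>v y) $ i" using i by (simp add: y_def)
    qed (use A in \<open>simp add: y_def\<close>)
    ultimately show ?thesis
      using A unfolding eigenvalue_def eigenvector_def by (intro exI[of _ y]) (simp add: y_def)
  qed
  moreover have "(\<exists>i<n. Re (w $ i) \<noteq> 0) \<or> (\<exists>i<n. Im (w $ i) \<noteq> 0)"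
    using ex by (auto simp: complex_eq_iff)
  ultimately show ?thesis by (auto simp: spectrum_def)
qed

lemma vertex_degree_eq_card_Image: "vertex_degree G v = card (parcs G `` {v})"
proof -
  have "parcs G `` {v} = snd ` {e \<in> parcs G. fst e = v}" by force
  moreover have "inj_on snd {e \<in> parcs G. fst e = v}" by (auto simp: inj_on_def)
  ultimately show ?thesis
    by (simp add: vertex_degree_def out_degree_def out_arcs_def card_image)
qed

text \<open>The spectrum is finite and nonempty, so \<open>Max\<close> picks an eigenvalue; its
  eigenvector becomes a function on the vertices, free of any listing.\<close>

lemma signless_spectral_radius_eigenfunction:
  assumes G: "pair_graph G" and ne: "pverts G \<noteq> {}"
  obtains x where "\<exists>v\<in>pverts G. x v \<noteq> 0"
    and "\<And>u. u \<in> pverts G \<Longrightarrow> real (card (parcs G `` {u})) * x u + (\<Sum>v\<in>parcs G `` {u}. x v)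
      = signless_spectral_radius G * x u"
proof -
  interpret pair_graph G by (rule G)
  define vs where "vs = vertex_list G"
  note vs = vertex_list[OF pair_finite_verts, folded vs_def]
  let ?Q = "signless_laplacian G vs"
  have Q: "?Q \<in> carrier_mat (length vs) (length vs)"
    by (simp add: signless_laplacian_def degree_mat_def adjacency_mat_def mat_diag_def)
  have sym: "sym (parcs G)" using pair_sym_arcs by (simp add: symmetric_def)
  have "spectrum ?Q \<noteq> {}"
  proof (rule real_symmetric_spectrum_nonempty[OF Q])
    show "length vs > 0" using ne vs by auto
    show "?Q $$ (i, j) = ?Q $$ (j, i)" if "i < length vs" "j < length vs" for i j
      using that sym
      by (auto simp: signless_laplacian_def degree_mat_def adjacency_mat_def mat_diag_def sym_def)
  qed
  then have "signless_spectral_radius G \<in> spectrum ?Q"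
    unfolding signless_spectral_radius_def vs_def[symmetric]
    by (intro Max_in card_finite_spectrum(1)[OF Q])
  then have "eigenvalue ?Q (signless_spectral_radius G)" by (simp add: spectrum_def)
  moreover have "{v. v \<in> pverts G \<and> (u, v) \<in> parcs G} = parcs G `` {u}" for u
    using wellformed' by auto
  ultimately show ?thesis
    using that unfolding eigenvalue_signless_laplacian[OF vs(1)] vs(2) vertex_degree_eq_card_Image
    by auto
qed

text \<open>
  Conjugating the signless Laplacian by the diagonal degree matrix turns the bound into one on a
  row sum; hence the vertex is taken where \<open>\<bar>x v\<bar> / d v\<close> is maximal.
\<close>

lemma signless_eigenvalue_le_row_sum:
  fixes x :: "'a \<Rightarrow> real" and c :: real
  assumes V: "finite V" and E: "E \<subseteq> V \<times> V"
    and pos: "\<And>v. v \<in> V \<Longrightarrow> E `` {v} \<noteq> {}"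
    and x: "\<exists>v\<in>V. x v \<noteq> 0"
    and eig: "\<And>u. u \<in> V \<Longrightarrow> real (card (E `` {u})) * x u + (\<Sum>v\<in>E `` {u}. x v) = c * x u"
  obtains v where "v \<in> V"
    and "c * card (E `` {v}) \<le> real (card (E `` {v})) ^ 2 + (\<Sum>u\<in>E `` {v}. card (E `` {u}))"
proof -
  let ?d = "\<lambda>v. real (card (E `` {v}))"
  have nsub: "E `` {v} \<subseteq> V" for v using E by auto
  have d: "?d v > 0" if "v \<in> V" for v
    using pos[OF that] finite_subset[OF nsub V] by (simp add: card_gt_0_iff)
  define y where "y v = \<bar>x v\<bar> / ?d v" for v
  have "V \<noteq> {}" using x by auto
  then obtain v where v: "v \<in> V" and max: "\<And>u. u \<in> V \<Longrightarrow> y u \<le> y v"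
    using obtains_MAX[OF V, of y] Max_ge[of "y ` V"] V by (metis finite_imageI imageI)
  have xy: "\<bar>x u\<bar> = ?d u * y u" if "u \<in> V" for u using d[OF that] by (simp add: y_def)
  obtain u where u: "u \<in> V" "x u \<noteq> 0" using x by auto
  then have "y u > 0" using d by (simp add: y_def)
  then have yv: "y v > 0" using max[OF u(1)] by simp
  have "c * \<bar>x v\<bar> \<le> ?d v * \<bar>x v\<bar> + (\<Sum>u\<in>E `` {v}. \<bar>x u\<bar>)"
  proof -
    have "(c - ?d v) * x v = (\<Sum>u\<in>E `` {v}. x u)" using eig[OF v] by (simp add: algebra_simps)
    then have "\<bar>c - ?d v\<bar> * \<bar>x v\<bar> \<le> (\<Sum>u\<in>E `` {v}. \<bar>x u\<bar>)"
      by (metis abs_mult sum_abs)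
    moreover have "(c - ?d v) * \<bar>x v\<bar> \<le> \<bar>c - ?d v\<bar> * \<bar>x v\<bar>" by (intro mult_right_mono) auto
    ultimately show ?thesis by (simp add: algebra_simps)
  qed
  also have "(\<Sum>u\<in>E `` {v}. \<bar>x u\<bar>) \<le> (\<Sum>u\<in>E `` {v}. ?d u * y v)"
  proof (rule sum_mono)
    fix u assume "u \<in> E `` {v}"
    then have "u \<in> V" using nsub by blast
    then show "\<bar>x u\<bar> \<le> ?d u * y v" using xy max by (simp add: mult_left_mono)
  qed
  also have "\<dots> = (\<Sum>u\<in>E `` {v}. ?d u) * y v" by (simp add: sum_distrib_right)
  finally have "(c * ?d v) * y v \<le> ((?d v) ^ 2 + (\<Sum>u\<in>E `` {v}. ?d u)) * y v"
    using xy[OF v] by (simp add: algebra_simps power2_eq_square)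
  then have "c * ?d v \<le> (?d v) ^ 2 + (\<Sum>u\<in>E `` {v}. ?d u)" using yv by simp
  then show ?thesis using that v by simp
qed

text \<open>\<open>card E\<close> counts arcs, that is, twice the edges. The row sum at one vertex
  is estimated by two bounds on the degree sum of its neighbours.\<close>

lemma signless_eigenvalue_le_size:
  fixes x :: "'a \<Rightarrow> real" and c :: real
  assumes V: "finite V" and E: "E \<subseteq> V \<times> V" "sym E" "irrefl E"
    and pos: "\<And>v. v \<in> V \<Longrightarrow> E `` {v} \<noteq> {}"
    and x: "\<exists>v\<in>V. x v \<noteq> 0"
    and eig: "\<And>u. u \<in> V \<Longrightarrow> real (card (E `` {u})) * x u + (\<Sum>v\<in>E `` {u}. x v) = c * x u"
  shows "c * (real (card V) - 1) \<le> card E + (real (card V) - 1) * (real (card V) - 2)"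
proof -
  obtain v where v: "v \<in> V" and row:
    "c * card (E `` {v}) \<le> real (card (E `` {v})) ^ 2 + (\<Sum>u\<in>E `` {v}. card (E `` {u}))"
    using signless_eigenvalue_le_row_sum[OF V E(1) pos x eig] by blast
  define N R where "N = E `` {v}" and "R = V - insert v N"
  have nsub: "E `` {u} \<subseteq> V" and nfin: "finite (E `` {u})" for u
    using E V by (auto intro: finite_subset[of _ V])
  have fin: "finite N" "finite R" using nfin V by (auto simp: N_def R_def)
  have vN: "v \<notin> N" using E by (auto simp: N_def irrefl_def)
  have Vd: "V = insert v (N \<union> R)" and NR: "N \<inter> R = {}" and vR: "v \<notin> R"
    using nsub v by (auto simp: N_def R_def)
  define d r S P where "d = card N" and "r = card R"
    and "S = (\<Sum>u\<in>N. card (E `` {u}))" and "P = (\<Sum>u\<in>R. card (E `` {u}))"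
  have cardV: "card V = d + r + 1"
    using fin vN vR NR by (subst Vd) (simp add: card_Un_disjoint d_def r_def)
  have cardE: "card E = d + S + P"
    using fin vN vR NR unfolding sum_card_Image[OF V E(1), symmetric]
    by (subst Vd) (simp add: sum.union_disjoint d_def S_def P_def N_def)
  have d: "d \<ge> 1" using pos[OF v] fin by (auto simp: d_def N_def Suc_le_eq card_gt_0_iff)
  have deg_le: "card (E `` {u}) \<le> d + r" if "u \<in> V" for u
  proof -
    have "card (E `` {u}) \<le> card (V - {u})"
      using nsub E V by (intro card_mono) (auto simp: irrefl_def)
    then show ?thesis using that V cardV by simp
  qed
  have S1: "S \<le> d * (d + r)"
    unfolding S_def d_def
    by (rule order.trans[OF sum_bounded_above]) (use deg_le nsub in \<open>auto simp: N_def d_def\<close>)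
  \<comment> \<open>A vertex of \<open>N\<close> has at most \<open>d\<close> neighbours in
    \<open>insert v N\<close>; the arcs from \<open>N\<close> to \<open>R\<close>, counted from
    \<open>R\<close>, number at most \<open>P\<close>.\<close>
  have S2: "S \<le> d * d + P"
  proof -
    have "card (E `` {u}) \<le> d + card (E `` {u} \<inter> R)" if u: "u \<in> N" for u
    proof -
      have "E `` {u} \<subseteq> (insert v N - {u}) \<union> (E `` {u} \<inter> R)"
        using nsub[of u] E Vd by (auto simp: irrefl_def)
      then have "card (E `` {u}) \<le> card ((insert v N - {u}) \<union> (E `` {u} \<inter> R))"
        using fin by (intro card_mono) auto
      also have "\<dots> \<le> card (insert v N - {u}) + card (E `` {u} \<inter> R)" by (rule card_Un_le)
      also have "card (insert v N - {u}) = d" using u fin vN by (simp add: d_def)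
      finally show ?thesis .
    qed
    then have "S \<le> (\<Sum>u\<in>N. d + card (E `` {u} \<inter> R))" unfolding S_def by (rule sum_mono)
    also have "\<dots> = d * d + (\<Sum>w\<in>R. card (E `` {w} \<inter> N))"
      using sum_card_Image_Int_swap[OF fin E(2)] by (simp add: sum.distrib d_def)
    also have "\<dots> \<le> d * d + P"
      unfolding P_def by (intro add_left_mono sum_mono card_mono nfin) auto
    finally show ?thesis .
  qed
  \<comment> \<open>This is the next inequality with its common terms cancelled. Split
    \<open>S r\<close> into \<open>S\<close> and \<open>S (r - 1)\<close>, using \<open>S2\<close>
    for the first and \<open>S1\<close> for the second; for \<open>r = 0\<close> the factor
    \<open>r - 1\<close> is negative.\<close>
  have "real S * r \<le> real d * (d + P) + real d * (d + r) * (real r - 1)"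
  proof (cases "r = 0")
    case True
    then show ?thesis by (simp add: algebra_simps)
  next
    case False
    have "real S * (real r - 1) \<le> real (d * (d + r)) * (real r - 1)"
    proof (rule mult_right_mono)
      show "real S \<le> real (d * (d + r))" using S1 by (simp only: of_nat_le_iff)
    qed (use False in simp)
    moreover have "S \<le> d * (d + P)"
      using S2 d by (metis add_le_mono1 distrib_left le_trans mult_le_mono1 nat_mult_1 add_left_mono)
    then have "real S \<le> real d * (d + P)" by (metis of_nat_le_iff of_nat_mult of_nat_add)
    ultimately show ?thesis by (simp add: algebra_simps)
  qed
  then have "(real d * d + S) * (d + r) \<le> real d * (real d + S + P + (real d + r) * (real d + r - 1))"
    by (simp add: algebra_simps)
  moreover have "c * d * (real d + r) \<le> (real d * d + S) * (real d + r)"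
    using row by (intro mult_right_mono) (simp_all add: d_def S_def N_def power2_eq_square)
  ultimately have "real d * (c * (real d + r)) \<le> real d * (real d + S + P + (real d + r) * (real d + r - 1))"
    by (simp add: algebra_simps)
  then have "c * (real d + r) \<le> real d + S + P + (real d + r) * (real d + r - 1)"
    using d by simp
  then show ?thesis by (simp add: cardV cardE)
qed

section \<open>From the number of edges to degree conditions and the theorem\<close>

text \<open>Arcs are counted by their tails. A tail outside \<open>S\<close> has at most
  \<open>card V - card S - 1\<close> heads outside \<open>S\<close>, and as many arcs enter
  \<open>S\<close> as leave it. For \<open>S\<close> of one or two vertices, a large
  \<open>card E\<close> forces large degrees.\<close>

lemma card_rel_le:
  assumes V: "finite V" and E: "E \<subseteq> V \<times> V" "sym E" "irrefl E" and S: "S \<subseteq> V"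
  shows "card E \<le> (\<Sum>u\<in>S. card (E `` {u}) + card (E `` {u} - S))
    + (card V - card S) * (card V - card S - 1)"
proof -
  let ?R = "V - S"
  have fin: "finite S" "finite ?R" using V S by (auto intro: finite_subset)
  have nsub: "E `` {u} \<subseteq> V" and nfin: "finite (E `` {u})" for u
    using E V by (auto intro: finite_subset[of _ V])
  have R: "card ?R = card V - card S" using V S by (simp add: card_Diff_subset fin)
  have "card (E `` {w}) \<le> card (E `` {w} \<inter> S) + (card V - card S - 1)" if w: "w \<in> ?R" for w
  proof -
    have "card (E `` {w}) \<le> card ((E `` {w} \<inter> S) \<union> (?R - {w}))"
      using fin nsub E by (intro card_mono) (auto simp: irrefl_def)
    also have "\<dots> \<le> card (E `` {w} \<inter> S) + card (?R - {w})" by (rule card_Un_le)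
    finally show ?thesis using w fin R by simp
  qed
  then have "(\<Sum>w\<in>?R. card (E `` {w})) \<le> (\<Sum>w\<in>?R. card (E `` {w} \<inter> S) + (card V - card S - 1))"
    by (rule sum_mono)
  also have "\<dots> = (\<Sum>u\<in>S. card (E `` {u} \<inter> ?R)) + (card V - card S) * (card V - card S - 1)"
    using sum_card_Image_Int_swap[OF fin(2,1) E(2)] R by (simp add: sum.distrib)
  also have "(\<Sum>u\<in>S. card (E `` {u} \<inter> ?R)) = (\<Sum>u\<in>S. card (E `` {u} - S))"
    using nsub by (intro sum.cong arg_cong[where f = card]) auto
  finally have "(\<Sum>w\<in>?R. card (E `` {w}))
    \<le> (\<Sum>u\<in>S. card (E `` {u} - S)) + (card V - card S) * (card V - card S - 1)" .
  moreover have "card E = (\<Sum>u\<in>S. card (E `` {u})) + (\<Sum>w\<in>?R. card (E `` {w}))"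
    using sum_card_Image[OF V E(1)] sum.subset_diff[OF S V, of "\<lambda>v. card (E `` {v})"] by simp
  ultimately show ?thesis by (simp add: sum.distrib)
qed

text \<open>Take the first arc of a walk from \<open>v\<close> to another vertex. Without isolated
  vertices, the spectral bound can divide by degrees.\<close>

lemma connected_Image_nonempty:
  assumes G: "pair_graph G" and conn: "Digraph_Component.connected (with_proj G)"
    and V: "card (pverts G) \<ge> 2" and v: "v \<in> pverts G"
  shows "parcs G `` {v} \<noteq> {}"
proof -
  interpret pair_graph G by (rule G)
  have sym: "sym (parcs G)" using pair_sym_arcs by (simp add: symmetric_def)
  have "\<not> pverts G \<subseteq> {v}" using V card_mono[of "{v}" "pverts G"] by auto
  then obtain u where u: "u \<in> pverts G" "u \<noteq> v" by blast
  have "v \<rightarrow>\<^sup>*\<^bsub>with_proj (mk_symmetric (with_proj G))\<^esub> u"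
    using conn v u by (auto simp: connected_def strongly_connected_def)
  then obtain w where "v \<rightarrow>\<^bsub>with_proj (mk_symmetric (with_proj G))\<^esub> w"
    using u(2) by (cases rule: pre_digraph.converse_reachable_cases) auto
  then have "(v, w) \<in> parcs G \<or> (w, v) \<in> parcs G"
    by (auto simp: parcs_mk_symmetric)
  then show ?thesis using sym by (auto simp: sym_def)
qed

theorem theorem1p3:
  fixes G :: "'a pair_pre_digraph" and k n :: nat
  assumes "k \<ge> 2" and "even k"
    and "pair_graph G" and "Digraph_Component.connected (with_proj G)"
    and "n = card (pverts G)"
    and "real n \<ge> (2 * real k + 3 + sqrt (8 * real k ^ 2 - 8 * real k + 1)) / 2"
    and "signless_spectral_radius G > 2 * (real n - 2) + (2 * real k - 2) / (real n - 1)"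
  shows "strong_parity_property k G"
proof -
  interpret pair_graph G by (rule assms)
  let ?V = "pverts G" and ?E = "parcs G"
  have V: "finite ?V" by (rule pair_finite_verts)
  have E: "?E \<subseteq> ?V \<times> ?V" "sym ?E" "irrefl ?E"
    using wellformed' pair_sym_arcs pair_no_loops by (auto simp: symmetric_def irrefl_def) force
  have nsub: "?E `` {u} \<subseteq> ?V" and nfin: "finite (?E `` {u})" for u
    using E V by (auto intro: finite_subset[of _ ?V])
  \<comment> \<open>With \<open>k \<ge> 2\<close> and a nonnegative root, the order bound exceeds
    3.\<close>
  have "sqrt (8 * real k ^ 2 - 8 * real k + 1) \<ge> 0"
    using assms(1) by (simp add: power2_eq_square)
  moreover have "real k \<ge> 2" using assms(1) by simp
  ultimately have "real n \<ge> 3" using assms(6) by argo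
  then have n: "n \<ge> 3" by simp
  \<comment> \<open>The complete graph has \<open>n (n - 1)\<close> arcs, so fewer than
    \<open>2 (n - k)\<close> are missing.\<close>
  have cardE_n: "card ?E > (n - 1) * (n - 2) + (2 * k - 2)"
  proof -
    have pos: "?E `` {v} \<noteq> {}" if "v \<in> ?V" for v
      using connected_Image_nonempty[OF assms(3,4)] that n assms(5) by simp
    have "?V \<noteq> {}" using n assms(5) by auto
    from signless_spectral_radius_eigenfunction[OF assms(3) this] obtain x
      where "\<exists>v\<in>?V. x v \<noteq> 0"
        "\<And>u. u \<in> ?V \<Longrightarrow> real (card (?E `` {u})) * x u + (\<Sum>v\<in>?E `` {u}. x v)
          = signless_spectral_radius G * x u" by blast
    from signless_eigenvalue_le_size[OF V E pos this]
    have "signless_spectral_radius G * (real n - 1) \<le> card ?E + (real n - 1) * (real n - 2)"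
      using assms(5) by simp
    moreover have "2 * (real n - 1) * (real n - 2) + (2 * real k - 2)
        < signless_spectral_radius G * (real n - 1)"
    proof -
      have "(2 * (real n - 2) + (2 * real k - 2) / (real n - 1)) * (real n - 1)
          < signless_spectral_radius G * (real n - 1)"
        using assms(7) n by (intro mult_strict_right_mono) auto
      moreover have "(2 * (real n - 2) + (2 * real k - 2) / (real n - 1)) * (real n - 1)
          = 2 * (real n - 1) * (real n - 2) + (2 * real k - 2)"
        using n by (simp add: field_simps)
      ultimately show ?thesis by simp
    qed
    ultimately have "(real n - 1) * (real n - 2) + (2 * real k - 2) < card ?E"
      by (simp add: algebra_simps)
    then have "real ((n - 1) * (n - 2) + (2 * k - 2)) < card ?E"
      using n assms(1) by (simp add: of_nat_diff)
    then show ?thesis by (simp only: of_nat_less_iff)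
  qed
  \<comment> \<open>The shift by 3 removes truncated subtraction from \<open>n - 1\<close> and
    \<open>n - 2\<close>.\<close>
  obtain m where m: "n = m + 3" using n by (metis le_Suc_ex add.commute)
  have cardE: "card ?E > (m + 2) * (m + 1) + (2 * k - 2)" using cardE_n by (simp add: m)
  have cardV: "card ?V = m + 3" using m assms(5) by simp
  \<comment> \<open>This is \<open>card_rel_le\<close> for \<open>{u, v}\<close>. If
    \<open>u v\<close> is an edge, each neighbourhood loses one vertex on removing
    \<open>{u, v}\<close>, whence the extra 2.\<close>
  have two: "2 * (card (?E `` {u}) + card (?E `` {v})) + (m + 1) * m
      \<ge> card ?E + (if (u, v) \<in> ?E then 2 else 0)"
    if uv: "u \<in> ?V" "v \<in> ?V" "u \<noteq> v" for u v
  proof -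
    have "card (?E `` {a} - {a, b}) + of_bool ((a, b) \<in> ?E) = card (?E `` {a})"
      if "a \<noteq> b" for a b
    proof -
      have "?E `` {a} - {a, b} = ?E `` {a} - {b}" using E(3) by (auto simp: irrefl_def)
      then show ?thesis using card_Suc_Diff1[OF nfin, of b a] by (cases "(a, b) \<in> ?E") auto
    qed
    note this[OF uv(3)] this[OF uv(3)[symmetric]]
    moreover have "(u, v) \<in> ?E \<longleftrightarrow> (v, u) \<in> ?E" using E(2) by (auto dest: symD)
    ultimately show ?thesis using card_rel_le[OF V E, of "{u, v}"] uv cardV
      by (auto simp: insert_commute[of v u] of_bool_def split: if_splits)
  qed
  have subgraph: "\<exists>F\<subseteq>?E. sym F \<and> (\<forall>v\<in>?V. odd (card (F `` {v})) = (v \<in> X)) \<and>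
      (\<forall>v\<in>?V. card (F `` {v}) + 1 \<ge> k)" if X: "X \<subseteq> ?V" "even (card X)" for X
  proof (rule parity_subgraph_of_large_degrees[OF V E X])
    show "1 \<le> k" using assms(1) by simp
    \<comment> \<open>For the single vertex \<open>v\<close>, \<open>card_rel_le\<close> leaves
      twice the degree above \<open>2 * k - 2\<close>.\<close>
    show "k \<le> card (?E `` {v})" if "v \<in> ?V" for v
    proof -
      have "?E `` {v} - {v} = ?E `` {v}" using E(3) by (auto simp: irrefl_def)
      then show ?thesis
        using card_rel_le[OF V E, of "{v}"] that cardE cardV by simp
    qed
    \<comment> \<open>By \<open>two\<close> and \<open>cardE\<close> the degree sum exceeds
      \<open>m + k + 1\<close> for adjacent and \<open>m + k\<close> for nonadjacent vertices;
      strictness gives the last unit.\<close>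
    show "card ?V + k \<le> card (?E `` {u}) + card (?E `` {v}) + 1" if "(u, v) \<in> ?E" for u v
    proof -
      have "u \<in> ?V" "v \<in> ?V" "u \<noteq> v" using that E(1,3) by (auto simp: irrefl_def)
      from two[OF this] show ?thesis using that cardE cardV by simp
    qed
    show "card ?V + k \<le> card (?E `` {u}) + card (?E `` {v}) + 2"
      if "u \<in> ?V" "v \<in> ?V" "u \<noteq> v" "(u, v) \<notin> ?E" for u v
      using two[OF that(1-3)] that(4) cardE cardV by simp
  qed
  show ?thesis
    unfolding strong_parity_property_def vertex_degree_eq_card_Image
  proof (intro allI impI)
    fix X assume X: "X \<subseteq> ?V \<and> even (card X)"
    then obtain F where F: "F \<subseteq> ?E" "sym F"
      and par: "\<And>v. v \<in> ?V \<Longrightarrow> odd (card (F `` {v})) = (v \<in> X)"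
      and low: "\<And>v. v \<in> ?V \<Longrightarrow> card (F `` {v}) + 1 \<ge> k"
      using subgraph[of X] by blast
    let ?F = "\<lparr>pverts = ?V, parcs = F\<rparr>"
    have pF: "pair_graph ?F"
    proof
      show "finite (parcs ?F)" using F(1) pair_finite_arcs by (auto intro: finite_subset)
    qed (use F V E(1) pair_no_loops in \<open>auto simp: symmetric_def\<close>)
    interpret F: pair_graph ?F by (rule pF)
    have "spanning (with_proj ?F) (with_proj G)"
      using F(1) wf_digraph_axioms F.wf_digraph_axioms by (auto simp: spanning_def subgraph_def)
    moreover have "card (F `` {v}) \<in> {k + 2 * j |j. True}" if "v \<in> ?V - X" for v
    proof -
      have ev: "even (card (F `` {v}))" using par that by auto
      moreover have "k \<le> card (F `` {v}) + 1" using low that by blast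
      ultimately have "k \<le> card (F `` {v})" using assms(2) by presburger
      then have "card (F `` {v}) = k + 2 * ((card (F `` {v}) - k) div 2)"
        using ev assms(2) by simp
      then show ?thesis by blast
    qed
    ultimately show "\<exists>F. pair_graph F \<and> spanning (with_proj F) (with_proj G) \<and>
        (\<forall>u\<in>X. odd (card (parcs F `` {u}))) \<and>
        (\<forall>v\<in>?V - X. card (parcs F `` {v}) \<in> {k + 2 * j |j. True})"
      using par X by (intro exI[of _ ?F]) (auto intro: pF)
  qed
qed

end
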